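(* Consider the noisy simple harmonic urn $(\tilde X_n,\tilde Y_n)_{n\in\mathbb Z_+}$ with noise $\kappa$ satisfying $\mathbb P(\kappa=1)=1$ (equivalently, the leaky simple harmonic urn up to the time $\tau$). Let $\tau=\min\{n\in\mathbb Z_+:|\tilde X_n|+|\tilde Y_n|=1\}$, for $n\in\mathbb N$ let $T_n$ be the area of the triangle with vertices $(0,0)$, $(\tilde X_{n-1},\tilde Y_{n-1})$ and $(\tilde X_n,\tilde Y_n)$, and let $A=\sum_{n=1}^{\tau}T_n$. Then $\mathbb E[A]=\infty$.
   Context: $\mathbb Z_+=\{0,1,2,\dots\}$, $\mathbb N=\{1,2,\dots\}$, and $\operatorname{sgn}(x)=-1,0,1$ according as $x<0$, $x=0$, $x>0$. The noisy simple harmonic urn with $\mathbb P(\kappa=1)=1$ is the Markov chain $(\tilde X_n,\tilde Y_n)_{n\in\mathbb Z_+}$ on $\mathbb Z^2\setminus\{(0,0)\}$ with $(\tilde X_0,\tilde Y_0)=(z_0,1)$, $z_0\in\mathbb N$, and the following transition law. Given $(\tilde X_n,\tilde Y_n)=(x,y)$ with $xy\neq0$, $$(\tilde X_{n+1},\tilde Y_{n+1})=\begin{cases}(x,y+\operatorname{sgn}(x)) & \text{with probability } \frac{|x|}{|x|+|y|},\\ (x-\operatorname{sgn}(y),y) & \text{with probability } \frac{|y|}{|x|+|y|};\end{cases}$$ if $x=0$, then $(\tilde X_{n+1},\tilde Y_{n+1})=(-\operatorname{sgn}(y),\ \operatorname{sgn}(y)\max(1,|y|-1))$; if $y=0$,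 then $(\tilde X_{n+1},\tilde Y_{n+1})=(\operatorname{sgn}(x)\max(1,|x|-1),\ \operatorname{sgn}(x))$. The leaky simple harmonic urn $(X'_n,Y'_n)$ has the same starting point $(z_0,1)$ and the same transitions when $xy\ne0$, while from $(0,y)$ it moves to $(-\operatorname{sgn}(y),y-\operatorname{sgn}(y))$ and from $(x,0)$ to $(x-\operatorname{sgn}(x),\operatorname{sgn}(x))$; the two processes coincide in law up to the first time $\tau$ at which $|x|+|y|=1$. *)

theory Defs
  imports "HOL-Probability.Probability" "HOL-Library.Extended_Nat"
begin

text \<open>Discrete-time Markov chain on a countable state space \<open>S\<close>, with transition law \<open>K\<close> and
  almost sure starting state \<open>s0\<close>.\<close>

definition markov_chain ::
  "'a measure \<Rightarrow> 's set \<Rightarrow> ('s \<Rightarrow> 's pmf) \<Rightarrow> 's \<Rightarrow> (nat \<Rightarrow> 'a \<Rightarrow> 's) \<Rightarrow> bool" where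
  "markov_chain M S K s0 Z \<longleftrightarrow>
     (\<forall>n. Z n \<in> measurable M (count_space S)) \<and>
     (AE \<omega> in M. Z 0 \<omega> = s0) \<and>
     (\<forall>n s t. \<P>(\<omega> in M. \<forall>i\<le>n. Z i \<omega> = s i) > 0 \<longrightarrow>
        \<P>(\<omega> in M. Z (Suc n) \<omega> = t \<bar> \<forall>i\<le>n. Z i \<omega> = s i) = pmf (K (s n)) t)"

text \<open>The noise is constantly 1. The origin is not a state; the value of the function there
  plays no role.\<close>

definition noisy_urn_step :: "int \<times> int \<Rightarrow> (int \<times> int) pmf" where
  "noisy_urn_step = (\<lambda>(x, y).
     if x = 0 then return_pmf (- sgn y, sgn y * max 1 (\<bar>y\<bar> - 1))
     else if y = 0 then return_pmf (sgn x * max 1 (\<bar>x\<bar> - 1), sgn x)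
     else map_pmf (\<lambda>b. if b then (x, y + sgn x) else (x - sgn y, y))
            (bernoulli_pmf (real_of_int \<bar>x\<bar> / real_of_int (\<bar>x\<bar> + \<bar>y\<bar>))))"

definition noisy_urn ::
  "'a measure \<Rightarrow> nat \<Rightarrow> (nat \<Rightarrow> 'a \<Rightarrow> int \<times> int) \<Rightarrow> bool" where
  "noisy_urn M z0 Z \<longleftrightarrow> markov_chain M (- {(0, 0)}) noisy_urn_step (int z0, 1) Z"

text \<open>The infimum of the empty set is \<open>\<infinity>\<close>.\<close>

definition urn_tau :: "(nat \<Rightarrow> 'a \<Rightarrow> int \<times> int) \<Rightarrow> 'a \<Rightarrow> enat" where
  "urn_tau Z \<omega> = Inf {enat n | n. \<bar>fst (Z n \<omega>)\<bar> + \<bar>snd (Z n \<omega>)\<bar> = 1}"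

definition plane_point :: "int \<times> int \<Rightarrow> real ^ 2" where
  "plane_point p = vector [real_of_int (fst p), real_of_int (snd p)]"

definition urn_triangle :: "(nat \<Rightarrow> 'a \<Rightarrow> int \<times> int) \<Rightarrow> nat \<Rightarrow> 'a \<Rightarrow> real" where
  "urn_triangle Z n \<omega> =
     measure lebesgue (convex hull {0, plane_point (Z (n - 1) \<omega>), plane_point (Z n \<omega>)})"

text \<open>The summand with index \<open>k\<close> is the triangle with index \<open>n = Suc k\<close>, so that the sum runs
  over \<open>1 \<le> n \<le> \<tau>\<close>, also if \<open>\<tau> = \<infinity>\<close>.\<close>

definition urn_area :: "(nat \<Rightarrow> 'a \<Rightarrow> int \<times> int) \<Rightarrow> 'a \<Rightarrow> ennreal" where
  "urn_area Z \<omega> =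
     (\<Sum>k. if enat (Suc k) \<le> urn_tau Z \<omega> then ennreal (urn_triangle Z (Suc k) \<omega>) else 0)"

end

theory Submission
  imports Defs
begin

text \<open>Let \<open>F\<close> be \<open>x\<^sup>2 + y\<^sup>2\<close> plus the linear term \<open>\<bar>x\<bar> - \<bar>y\<bar>\<close>, \<open>\<bar>y\<bar> - \<bar>x\<bar>\<close> or \<open>- \<bar>x\<bar> - \<bar>y\<bar>\<close>, according as
  \<open>x y\<close> is positive, negative or zero. It is an exact martingale up to \<open>\<tau>\<close> and vanishes at \<open>\<tau>\<close>, so
  \<open>E[F(Z\<^sub>n); n < \<tau>]\<close> equals \<open>F(z\<^sub>0, 1) > 0\<close> for every \<open>n\<close>. With \<open>r = \<bar>x\<bar> + \<bar>y\<bar>\<close>, the mean area \<open>a\<close> of a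
  step is at least \<open>r / 4\<close>, while \<open>\<surd>F \<le> 2 r\<close>, and \<open>F\<close> to the power \<open>3/2\<close> has drift at most
  \<open>4 r \<le> 16 a\<close>. By Cauchy--Schwarz, \<open>F(z\<^sub>0, 1)\<^sup>2\<close> is at most \<open>16 E[a(Z\<^sub>n); n < \<tau>]\<close> times the
  expectation of \<open>F\<close> to the power \<open>3/2\<close> on \<open>n < \<tau>\<close>, which is at most its initial value plus
  \<open>16 E[A]\<close>. Summation over \<open>n\<close> yields \<open>\<infinity> \<le> E[A] (c + d E[A])\<close> with finite \<open>c\<close> and \<open>d\<close>. Everything is
  invariant under quarter turns of the plane, so the estimates need only be checked in the first
  quadrant.\<close>

section \<open>Integrals and expectations\<close>

lemma nn_integral_countable_valued:
  fixes X :: "'a \<Rightarrow> 'b::countable" and f :: "'b \<Rightarrow> ennreal"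
  assumes [measurable]: "X \<in> measurable M (count_space UNIV)"
  shows "(\<integral>\<^sup>+\<omega>. f (X \<omega>) \<partial>M) =
    (\<integral>\<^sup>+x. emeasure M {\<omega> \<in> space M. X \<omega> = x} * f x \<partial>count_space UNIV)"
proof -
  have "distr M (count_space UNIV) X =
      density (count_space UNIV) (\<lambda>x. emeasure M {\<omega> \<in> space M. X \<omega> = x})"
    by (rule measure_eqI_countable[where A = UNIV])
       (auto simp: emeasure_distr emeasure_density nn_integral_count_space_indicator[symmetric]
         vimage_def Int_def conj_commute)
  then have "(\<integral>\<^sup>+x. f x \<partial>distr M (count_space UNIV) X) =
      (\<integral>\<^sup>+x. emeasure M {\<omega> \<in> space M. X \<omega> = x} * f x \<partial>count_space UNIV)"
    by (simp add: nn_integral_density)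
  then show ?thesis
    by (simp add: nn_integral_distr)
qed

lemma measurable_Pair_count_space:
  fixes X :: "'a \<Rightarrow> 'b::countable" and Y :: "'a \<Rightarrow> 'c::countable"
  assumes "X \<in> measurable M (count_space UNIV)" "Y \<in> measurable M (count_space UNIV)"
  shows "(\<lambda>\<omega>. (X \<omega>, Y \<omega>)) \<in> measurable M (count_space UNIV)"
  using measurable_Pair[OF assms] by (simp add: pair_measure_countable)

lemma nn_integral_square_le_mult:
  fixes f g h :: "'a \<Rightarrow> real"
  assumes [measurable]: "g \<in> borel_measurable M" "h \<in> borel_measurable M"
    and g: "\<And>x. 0 \<le> g x" and h: "\<And>x. 0 \<le> h x"
    and square_le: "AE x in M. (f x)\<^sup>2 \<le> g x * h x"
  shows "(\<integral>\<^sup>+x. ennreal (f x) \<partial>M)\<^sup>2 \<le> (\<integral>\<^sup>+x. ennreal (g x) \<partial>M) * (\<integral>\<^sup>+x. ennreal (h x) \<partial>M)"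
proof -
  have "AE x in M. ennreal (f x) \<le> ennreal (sqrt (g x)) * ennreal (sqrt (h x))"
    using square_le
  proof eventually_elim
    case (elim x)
    then have "f x \<le> sqrt (g x) * sqrt (h x)"
      by (metis real_le_rsqrt real_sqrt_mult)
    then show ?case
      by (simp add: g h ennreal_leI flip: ennreal_mult)
  qed
  then have "(\<integral>\<^sup>+x. ennreal (f x) \<partial>M)\<^sup>2 \<le> (\<integral>\<^sup>+x. ennreal (sqrt (g x)) * ennreal (sqrt (h x)) \<partial>M)\<^sup>2"
    by (intro power_mono nn_integral_mono_AE) auto
  also have "\<dots> \<le> (\<integral>\<^sup>+x. (ennreal (sqrt (g x)))\<^sup>2 \<partial>M) * (\<integral>\<^sup>+x. (ennreal (sqrt (h x)))\<^sup>2 \<partial>M)"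
    by (rule Cauchy_Schwarz_nn_integral) auto
  finally show ?thesis
    by (simp add: g h ennreal_power)
qed

lemma suminf_const_ennreal_eq_top:
  fixes a :: ennreal
  assumes "a \<noteq> 0"
  shows "(\<Sum>n::nat. a) = \<top>"
  using assms by (simp add: nn_integral_count_space_nat[symmetric] ennreal_mult_top)

lemma sqrt_cube_taylor_le:
  fixes u v :: real
  assumes "0 < u" "0 \<le> v"
  shows "sqrt v ^ 3 \<le> sqrt u ^ 3 + 3 / 2 * sqrt u * (v - u) + (v - u)\<^sup>2 / sqrt u"
proof -
  define s t where "s = sqrt u" and "t = sqrt v"
  have s: "0 < s" and t: "0 \<le> t" and u: "u = s\<^sup>2" and v: "v = t\<^sup>2"
    using assms by (auto simp: s_def t_def)
  have "s * (t + s / 2) \<le> (t + s)\<^sup>2"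
    using s t by (simp add: power2_eq_square algebra_simps)
  then have "(t - s)\<^sup>2 * (s * (t + s / 2)) \<le> (t - s)\<^sup>2 * (t + s)\<^sup>2"
    by (rule mult_left_mono) simp
  then have remainder_le: "(t - s)\<^sup>2 * (t + s / 2) \<le> (v - u)\<^sup>2 / s"
    using s by (simp add: field_simps u v power2_eq_square)
  have "t ^ 3 = s ^ 3 + 3 / 2 * s * (v - u) + (t - s)\<^sup>2 * (t + s / 2)"
    by (simp add: u v power2_eq_square power3_eq_cube field_simps)
  then show ?thesis
    using remainder_le by (simp add: s_def t_def)
qed

lemma (in prob_space) expectation_sqrt_cube_le:
  fixes X :: "'a \<Rightarrow> real"
  assumes [measurable]: "random_variable borel X"
    and square_integrable: "integrable M (\<lambda>\<omega>. (X \<omega>)\<^sup>2)"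
    and nonneg: "AE \<omega> in M. 0 \<le> X \<omega>" and pos: "0 < expectation X"
  shows "expectation (\<lambda>\<omega>. sqrt (X \<omega>) ^ 3) \<le>
    sqrt (expectation X) ^ 3 + variance X / sqrt (expectation X)"
proof -
  define u where "u = expectation X"
  let ?T = "\<lambda>\<omega>. sqrt u ^ 3 + 3 / 2 * sqrt u * (X \<omega> - u) + (X \<omega> - u)\<^sup>2 / sqrt u"
  have integrable_X: "integrable M X"
    using square_integrable by (rule square_integrable_imp_integrable[rotated]) simp
  then have integrable_deviation: "integrable M (\<lambda>\<omega>. (X \<omega> - u)\<^sup>2)"
    using square_integrable by (simp add: power2_diff)
  have taylor: "AE \<omega> in M. sqrt (X \<omega>) ^ 3 \<le> ?T \<omega>"
    using nonneg by eventually_elim (rule sqrt_cube_taylor_le, simp_all add: pos u_def)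
  have "expectation (\<lambda>\<omega>. sqrt (X \<omega>) ^ 3) \<le> expectation ?T"
  proof (rule integral_mono_AE'[OF _ taylor])
    show "integrable M ?T"
      using integrable_X integrable_deviation by simp
    show "AE \<omega> in M. 0 \<le> ?T \<omega>"
      using nonneg taylor by eventually_elim (metis order_trans real_sqrt_ge_zero zero_le_power)
  qed
  also have "expectation ?T = sqrt u ^ 3 + variance X / sqrt u"
    using integrable_X integrable_deviation by (simp add: prob_space u_def)
  finally show ?thesis
    by (simp add: u_def)
qed

lemma map_pmf_Not_bernoulli_pmf:
  assumes "0 \<le> p" "p \<le> 1"
  shows "map_pmf Not (bernoulli_pmf p) = bernoulli_pmf (1 - p)"
proof (rule pmf_eqI)
  fix b
  have "pmf (map_pmf Not (bernoulli_pmf p)) (\<not> \<not> b) = pmf (bernoulli_pmf p) (\<not> b)"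
    by (rule pmf_map_inj') (simp add: inj_def)
  then show "pmf (map_pmf Not (bernoulli_pmf p)) b = pmf (bernoulli_pmf (1 - p)) b"
    using assms by (cases b) auto
qed

section \<open>Countable Markov chains killed on a set\<close>

locale countable_markov_chain = prob_space M
  for M :: "'a measure" +
  fixes S :: "'s::countable set" and K :: "'s \<Rightarrow> 's pmf" and s0 :: 's and Z :: "nat \<Rightarrow> 'a \<Rightarrow> 's"
  assumes markov_chain: "markov_chain M S K s0 Z"
begin

lemma measurable_state: "Z n \<in> measurable M (count_space S)"
  using markov_chain by (simp add: markov_chain_def)

lemma measurable_state_UNIV [measurable]: "Z n \<in> measurable M (count_space UNIV)"
  using measurable_compose[OF measurable_state, of "\<lambda>s. s" "count_space UNIV"] by simp

lemma state_in_S: "\<omega> \<in> space M \<Longrightarrow> Z n \<omega> \<in> S"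
  using measurable_space[OF measurable_state] by simp

lemma AE_initial_state: "AE \<omega> in M. Z 0 \<omega> = s0"
  using markov_chain by (simp add: markov_chain_def)

lemma emeasure_path_Suc:
  "emeasure M {\<omega> \<in> space M. (\<forall>i\<le>n. Z i \<omega> = s i) \<and> Z (Suc n) \<omega> = t} =
    emeasure M {\<omega> \<in> space M. \<forall>i\<le>n. Z i \<omega> = s i} * ennreal (pmf (K (s n)) t)"
proof -
  let ?A = "{\<omega> \<in> space M. \<forall>i\<le>n. Z i \<omega> = s i}"
  let ?B = "{\<omega> \<in> space M. (\<forall>i\<le>n. Z i \<omega> = s i) \<and> Z (Suc n) \<omega> = t}"
  have "prob ?B = prob ?A * pmf (K (s n)) t"
  proof (cases "prob ?A > 0")
    case True
    then have "\<P>(\<omega> in M. Z (Suc n) \<omega> = t \<bar> \<forall>i\<le>n. Z i \<omega> = s i) = pmf (K (s n)) t"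
      using markov_chain by (auto simp: markov_chain_def)
    then show ?thesis
      using True by (simp add: cond_prob_def field_simps conj_commute)
  next
    case False
    moreover have "prob ?B \<le> prob ?A"
      by (intro finite_measure_mono) auto
    ultimately show ?thesis
      by (simp add: zero_less_measure_iff measure_le_0_iff)
  qed
  then show ?thesis
    by (simp add: emeasure_eq_measure ennreal_mult)
qed

definition history :: "nat \<Rightarrow> 'a \<Rightarrow> 's list" where
  "history n \<omega> = map (\<lambda>i. Z i \<omega>) [0..<Suc n]"

lemma history_eq_iff: "history n \<omega> = l \<longleftrightarrow> length l = Suc n \<and> (\<forall>i\<le>n. Z i \<omega> = l ! i)"
  by (auto simp: history_def list_eq_iff_nth_eq less_Suc_eq_le simp del: upt_Suc)

lemma set_history: "set (history n \<omega>) = (\<lambda>i. Z i \<omega>) ` {..n}"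
  by (auto simp: history_def less_Suc_eq_le simp del: upt_Suc)

lemma last_history: "last (history n \<omega>) = Z n \<omega>"
  by (simp add: history_def)

lemma measurable_history [measurable]: "history n \<in> measurable M (count_space UNIV)"
proof -
  have "history n -` {l} \<inter> space M = {\<omega> \<in> space M. length l = Suc n \<and> (\<forall>i\<le>n. Z i \<omega> = l ! i)}" for l
    by (rule set_eqI) (simp add: history_eq_iff conj_commute)
  then show ?thesis
    by (simp add: measurable_count_space_eq2_countable)
qed

lemma emeasure_history_Suc:
  "emeasure M {\<omega> \<in> space M. history n \<omega> = l \<and> Z (Suc n) \<omega> = t} =
    emeasure M {\<omega> \<in> space M. history n \<omega> = l} * ennreal (pmf (K (last l)) t)"
proof (cases "length l = Suc n")
  case True
  then have "l ! n = last l"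
    by (metis diff_Suc_1 last_conv_nth length_0_conv nat.distinct(1))
  with True show ?thesis
    using emeasure_path_Suc[of n "\<lambda>i. l ! i" t] by (simp add: history_eq_iff)
qed (simp add: history_eq_iff)

lemma nn_integral_history_Suc:
  "(\<integral>\<^sup>+\<omega>. g (history n \<omega>) (Z (Suc n) \<omega>) \<partial>M) =
    (\<integral>\<^sup>+\<omega>. (\<integral>\<^sup>+t. g (history n \<omega>) t \<partial>K (Z n \<omega>)) \<partial>M)"
proof -
  have [measurable]: "(\<lambda>\<omega>. (history n \<omega>, Z (Suc n) \<omega>)) \<in> measurable M (count_space UNIV)"
    by (intro measurable_Pair_count_space) auto
  have "(\<integral>\<^sup>+\<omega>. g (history n \<omega>) (Z (Suc n) \<omega>) \<partial>M) =
      (\<integral>\<^sup>+(l, t). emeasure M {\<omega> \<in> space M. history n \<omega> = l \<and> Z (Suc n) \<omega> = t} * g l t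
        \<partial>count_space UNIV)"
    using nn_integral_countable_valued[of "\<lambda>\<omega>. (history n \<omega>, Z (Suc n) \<omega>)" M "case_prod g"]
    by (simp add: case_prod_unfold prod_eq_iff)
  also have "\<dots> = (\<integral>\<^sup>+l. \<integral>\<^sup>+t. emeasure M {\<omega> \<in> space M. history n \<omega> = l} *
      (ennreal (pmf (K (last l)) t) * g l t) \<partial>count_space UNIV \<partial>count_space UNIV)"
    by (subst nn_integral_fst_count_space[symmetric]) (simp add: emeasure_history_Suc mult.assoc)
  also have "\<dots> = (\<integral>\<^sup>+l. emeasure M {\<omega> \<in> space M. history n \<omega> = l} *
      (\<integral>\<^sup>+t. g l t \<partial>K (last l)) \<partial>count_space UNIV)"
    by (simp add: nn_integral_cmult nn_integral_measure_pmf)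
  also have "\<dots> = (\<integral>\<^sup>+\<omega>. (\<integral>\<^sup>+t. g (history n \<omega>) t \<partial>K (Z n \<omega>)) \<partial>M)"
    by (subst nn_integral_countable_valued[symmetric]) (simp_all add: last_history)
  finally show ?thesis .
qed

definition surviving :: "'s set \<Rightarrow> nat \<Rightarrow> 'a set" where
  "surviving D n = {\<omega> \<in> space M. \<forall>i\<le>n. Z i \<omega> \<notin> D}"

definition killed_law :: "'s set \<Rightarrow> nat \<Rightarrow> 's measure" where
  "killed_law D n = distr (density M (indicator (surviving D n))) (count_space UNIV) (Z n)"

lemma sets_surviving [measurable]: "surviving D n \<in> sets M"
  unfolding surviving_def by measurable

lemma borel_measurable_killed_law [measurable, simp]: "f \<in> borel_measurable (killed_law D n)"
  by (simp add: killed_law_def)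

lemma nn_integral_killed_law:
  "(\<integral>\<^sup>+s. h s \<partial>killed_law D n) = (\<integral>\<^sup>+\<omega>. h (Z n \<omega>) * indicator (surviving D n) \<omega> \<partial>M)"
proof -
  have [measurable]: "(\<lambda>\<omega>. h (Z n \<omega>)) \<in> borel_measurable M"
    by (rule measurable_compose[OF measurable_state_UNIV]) simp
  show ?thesis
    by (simp add: killed_law_def nn_integral_distr nn_integral_density mult.commute)
qed

lemma AE_killed_law: "AE s in killed_law D n. s \<in> S - D"
  unfolding killed_law_def
  by (subst AE_distr_iff) (auto simp: AE_density surviving_def indicator_def state_in_S)

lemma nn_integral_surviving_Suc:
  "(\<integral>\<^sup>+\<omega>. h (Z n \<omega>) (Z (Suc n) \<omega>) * indicator (surviving D n) \<omega> \<partial>M) =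
    (\<integral>\<^sup>+s. \<integral>\<^sup>+t. h s t \<partial>K s \<partial>killed_law D n)"
proof -
  let ?alive = "\<lambda>l. indicator {l. set l \<inter> D = {}} l :: ennreal"
  have alive: "indicator (surviving D n) \<omega> = ?alive (history n \<omega>)" if "\<omega> \<in> space M" for \<omega>
    using that by (auto simp: surviving_def set_history indicator_def)
  have "(\<integral>\<^sup>+\<omega>. h (Z n \<omega>) (Z (Suc n) \<omega>) * indicator (surviving D n) \<omega> \<partial>M) =
      (\<integral>\<^sup>+\<omega>. h (last (history n \<omega>)) (Z (Suc n) \<omega>) * ?alive (history n \<omega>) \<partial>M)"
    by (intro nn_integral_cong) (simp add: alive last_history)
  also have "\<dots> = (\<integral>\<^sup>+\<omega>. (\<integral>\<^sup>+t. h (Z n \<omega>) t * ?alive (history n \<omega>) \<partial>K (Z n \<omega>)) \<partial>M)"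
    using nn_integral_history_Suc[of "\<lambda>l t. h (last l) t * ?alive l" n]
    by (simp only: last_history)
  also have "\<dots> = (\<integral>\<^sup>+\<omega>. (\<integral>\<^sup>+t. h (Z n \<omega>) t \<partial>K (Z n \<omega>)) * indicator (surviving D n) \<omega> \<partial>M)"
    by (intro nn_integral_cong) (simp add: alive nn_integral_multc)
  finally show ?thesis
    by (simp add: nn_integral_killed_law)
qed

lemma nn_integral_killed_law_0:
  assumes "s0 \<notin> D"
  shows "(\<integral>\<^sup>+s. h s \<partial>killed_law D 0) = h s0"
proof -
  have "(\<integral>\<^sup>+s. h s \<partial>killed_law D 0) = (\<integral>\<^sup>+\<omega>. h s0 \<partial>M)"
    unfolding nn_integral_killed_law
    by (rule nn_integral_cong_AE, use AE_initial_state AE_space in eventually_elim)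
       (use assms in \<open>simp add: surviving_def indicator_def\<close>)
  then show ?thesis
    by (simp add: emeasure_space_1)
qed

lemma nn_integral_killed_law_Suc:
  assumes "\<And>s. s \<in> D \<Longrightarrow> h s = 0"
  shows "(\<integral>\<^sup>+s. h s \<partial>killed_law D (Suc n)) = (\<integral>\<^sup>+s. \<integral>\<^sup>+t. h t \<partial>K s \<partial>killed_law D n)"
proof -
  have "(\<integral>\<^sup>+s. h s \<partial>killed_law D (Suc n)) =
      (\<integral>\<^sup>+\<omega>. h (Z (Suc n) \<omega>) * indicator (surviving D n) \<omega> \<partial>M)"
    unfolding nn_integral_killed_law using assms
    by (intro nn_integral_cong) (auto simp: surviving_def indicator_def le_Suc_eq)
  then show ?thesis
    using nn_integral_surviving_Suc[of "\<lambda>_. h"] by simp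
qed

lemma nn_integral_killed_law_harmonic:
  assumes "s0 \<notin> D" "\<And>s. s \<in> D \<Longrightarrow> h s = 0"
    and harmonic: "\<And>s. s \<in> S - D \<Longrightarrow> (\<integral>\<^sup>+t. h t \<partial>K s) = h s"
  shows "(\<integral>\<^sup>+s. h s \<partial>killed_law D n) = h s0"
proof (induction n)
  case 0
  show ?case by (rule nn_integral_killed_law_0) fact
next
  case (Suc n)
  have "(\<integral>\<^sup>+s. h s \<partial>killed_law D (Suc n)) = (\<integral>\<^sup>+s. \<integral>\<^sup>+t. h t \<partial>K s \<partial>killed_law D n)"
    using assms(2) by (rule nn_integral_killed_law_Suc)
  also have "\<dots> = (\<integral>\<^sup>+s. h s \<partial>killed_law D n)"
    by (rule nn_integral_cong_AE, use AE_killed_law in eventually_elim) (rule harmonic)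
  finally show ?case
    by (simp only: Suc)
qed

lemma nn_integral_killed_law_drift_le:
  assumes "s0 \<notin> D" "\<And>s. s \<in> D \<Longrightarrow> h s = 0"
    and drift: "\<And>s. s \<in> S - D \<Longrightarrow> (\<integral>\<^sup>+t. h t \<partial>K s) \<le> h s + r s"
  shows "(\<integral>\<^sup>+s. h s \<partial>killed_law D n) \<le> h s0 + (\<Sum>k<n. \<integral>\<^sup>+s. r s \<partial>killed_law D k)"
proof (induction n)
  case 0
  show ?case by (simp add: nn_integral_killed_law_0 assms(1))
next
  case (Suc n)
  have "(\<integral>\<^sup>+s. h s \<partial>killed_law D (Suc n)) = (\<integral>\<^sup>+s. \<integral>\<^sup>+t. h t \<partial>K s \<partial>killed_law D n)"
    using assms(2) by (rule nn_integral_killed_law_Suc)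
  also have "\<dots> \<le> (\<integral>\<^sup>+s. h s + r s \<partial>killed_law D n)"
    by (rule nn_integral_mono_AE, use AE_killed_law in eventually_elim) (rule drift)
  also have "\<dots> = (\<integral>\<^sup>+s. h s \<partial>killed_law D n) + (\<integral>\<^sup>+s. r s \<partial>killed_law D n)"
    by (rule nn_integral_add) auto
  also have "\<dots> \<le> h s0 + (\<Sum>k<n. \<integral>\<^sup>+s. r s \<partial>killed_law D k) + (\<integral>\<^sup>+s. r s \<partial>killed_law D n)"
    by (intro add_right_mono Suc)
  finally show ?case
    by (simp add: add.assoc)
qed

text \<open>By Cauchy--Schwarz \<open>E[F]\<^sup>2 \<le> E[r] E[G]\<close> at every time; the left-hand side is constant and \<open>E[G]\<close> is
  bounded by \<open>G s0\<close> plus the sum in question.\<close>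

lemma suminf_nn_integral_killed_law_eq_top:
  fixes F G r :: "'s \<Rightarrow> real"
  assumes start: "s0 \<notin> D" "0 < F s0"
    and nonneg: "\<And>s. 0 \<le> G s" "\<And>s. 0 \<le> r s"
    and on_D: "\<And>s. s \<in> D \<Longrightarrow> F s = 0" "\<And>s. s \<in> D \<Longrightarrow> G s = 0"
    and harmonic: "\<And>s. s \<in> S - D \<Longrightarrow> (\<integral>\<^sup>+t. ennreal (F t) \<partial>K s) = ennreal (F s)"
    and drift: "\<And>s. s \<in> S - D \<Longrightarrow> (\<integral>\<^sup>+t. ennreal (G t) \<partial>K s) \<le> ennreal (G s) + ennreal (r s)"
    and square_le: "\<And>s. s \<in> S - D \<Longrightarrow> (F s)\<^sup>2 \<le> r s * G s"
  shows "(\<Sum>n. \<integral>\<^sup>+s. ennreal (r s) \<partial>killed_law D n) = \<top>"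
proof -
  let ?R = "\<lambda>n. \<integral>\<^sup>+s. ennreal (r s) \<partial>killed_law D n"
  have bound: "(ennreal (F s0))\<^sup>2 \<le> ?R n * (ennreal (G s0) + (\<Sum>k. ?R k))" for n
  proof -
    have "(ennreal (F s0))\<^sup>2 = (\<integral>\<^sup>+s. ennreal (F s) \<partial>killed_law D n)\<^sup>2"
      by (subst nn_integral_killed_law_harmonic) (simp_all add: start on_D harmonic)
    also have "\<dots> \<le> ?R n * (\<integral>\<^sup>+s. ennreal (G s) \<partial>killed_law D n)"
    proof (rule nn_integral_square_le_mult)
      show "AE s in killed_law D n. (F s)\<^sup>2 \<le> r s * G s"
        using AE_killed_law by eventually_elim (rule square_le)
    qed (simp_all add: nonneg)
    also have "(\<integral>\<^sup>+s. ennreal (G s) \<partial>killed_law D n) \<le> ennreal (G s0) + (\<Sum>k<n. ?R k)"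
      by (rule nn_integral_killed_law_drift_le) (simp_all add: start on_D drift)
    also have "(\<Sum>k<n. ?R k) \<le> (\<Sum>k. ?R k)"
      by (rule sum_le_suminf) auto
    finally show ?thesis
      by (simp add: mult_left_mono add_left_mono)
  qed
  have "\<top> = (\<Sum>n. (ennreal (F s0))\<^sup>2)"
    using start by (simp add: suminf_const_ennreal_eq_top)
  also have "\<dots> \<le> (\<Sum>n. ?R n * (ennreal (G s0) + (\<Sum>k. ?R k)))"
    by (intro suminf_le bound) auto
  also have "\<dots> = (\<Sum>k. ?R k) * (ennreal (G s0) + (\<Sum>k. ?R k))"
    by (rule ennreal_suminf_multc)
  finally show ?thesis
    by (auto simp: top_unique ennreal_mult_eq_top_iff)
qed

end

section \<open>The noisy simple harmonic urn\<close>

definition quarter_turn :: "int \<times> int \<Rightarrow> int \<times> int" where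
  "quarter_turn = (\<lambda>(x, y). (- y, x))"

lemma quarter_turn_Pair [simp]: "quarter_turn (x, y) = (- y, x)"
  by (simp add: quarter_turn_def)

lemma quarter_turn_induct [consumes 1, case_names first_quadrant turn]:
  assumes "s \<noteq> (0, 0)"
    and first_quadrant: "\<And>x y. 0 < x \<Longrightarrow> 0 \<le> y \<Longrightarrow> P (x, y)"
    and turn: "\<And>s. P s \<Longrightarrow> P (quarter_turn s)"
  shows "P s"
proof (cases s)
  case (Pair x y)
  have turn_from: "P (v, - u) \<Longrightarrow> P (u, v)" for u v
    using turn[of "(v, - u)"] by simp
  consider (first) "0 < x" "0 \<le> y" | (second) "x \<le> 0" "0 < y"
    | (third) "x < 0" "y \<le> 0" | (fourth) "0 \<le> x" "y < 0"
    using assms(1) Pair by fastforce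
  then have "P (x, y)"
  proof cases
    case first
    then show ?thesis by (rule first_quadrant)
  next
    case second
    then show ?thesis by (intro turn_from[of y] first_quadrant) auto
  next
    case third
    then show ?thesis by (intro turn_from[of y] turn_from[of "- x"] first_quadrant) auto
  next
    case fourth
    then show ?thesis
      by (intro turn_from[of y] turn_from[of "- x"] turn_from[of "- y"] first_quadrant) auto
  qed
  then show ?thesis by (simp only: Pair)
qed

lemma noisy_urn_step_quarter_turn:
  "noisy_urn_step (quarter_turn s) = map_pmf quarter_turn (noisy_urn_step s)"
proof (cases s)
  case (Pair x y)
  show ?thesis
  proof (cases "x = 0 \<or> y = 0")
    case True
    then show ?thesis
      by (auto simp: Pair noisy_urn_step_def)
  next
    case False
    define p where "p = real_of_int \<bar>x\<bar> / real_of_int (\<bar>x\<bar> + \<bar>y\<bar>)"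
    have p: "0 \<le> p" "p \<le> 1" "real_of_int \<bar>y\<bar> / real_of_int (\<bar>y\<bar> + \<bar>x\<bar>) = 1 - p"
    proof -
      have "real_of_int (\<bar>x\<bar> + \<bar>y\<bar>) \<noteq> 0"
        using False by linarith
      then show "0 \<le> p" "p \<le> 1" "real_of_int \<bar>y\<bar> / real_of_int (\<bar>y\<bar> + \<bar>x\<bar>) = 1 - p"
        by (simp_all add: p_def field_simps del: of_int_abs)
    qed
    have "noisy_urn_step (quarter_turn s) =
        map_pmf (\<lambda>b. if b then (- y, x - sgn y) else (- y - sgn x, x)) (bernoulli_pmf (1 - p))"
      using False
      by (simp add: Pair noisy_urn_step_def flip: p(3) del: of_int_abs of_int_add cong: if_cong)
    also have "\<dots> = map_pmf (\<lambda>b. quarter_turn (if b then (x, y + sgn x) else (x - sgn y, y)))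
        (bernoulli_pmf p)"
      unfolding map_pmf_Not_bernoulli_pmf[OF p(1,2), symmetric] pmf.map_comp
      by (intro map_pmf_cong) auto
    also have "\<dots> = map_pmf quarter_turn (noisy_urn_step s)"
      using False by (simp add: Pair noisy_urn_step_def pmf.map_comp comp_def p_def)
    finally show ?thesis .
  qed
qed

lemma expectation_noisy_urn_step_interior:
  fixes f :: "int \<times> int \<Rightarrow> real"
  assumes "0 < x" "0 < y"
  shows "measure_pmf.expectation (noisy_urn_step (x, y)) f =
    (x * f (x, y + 1) + y * f (x - 1, y)) / (x + y)"
proof -
  have "1 - x / (x + y) = y / (x + y)"
    using assms by (simp add: field_simps)
  with assms show ?thesis
    by (simp add: noisy_urn_step_def add_divide_distrib mult.commute)
qed

lemma noisy_urn_step_axis: "2 \<le> x \<Longrightarrow> noisy_urn_step (x, 0) = return_pmf (x - 1, 1)"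
  by (simp add: noisy_urn_step_def)

lemma finite_set_pmf_noisy_urn_step: "finite (set_pmf (noisy_urn_step s))"
  by (cases s) (simp add: noisy_urn_step_def)

lemma nn_integral_noisy_urn_step:
  assumes "\<And>t. 0 \<le> f t"
  shows "(\<integral>\<^sup>+t. ennreal (f t) \<partial>noisy_urn_step s) =
    ennreal (measure_pmf.expectation (noisy_urn_step s) f)"
  using assms
  by (intro nn_integral_eq_integral integrable_measure_pmf_finite finite_set_pmf_noisy_urn_step) simp

definition urn_size :: "int \<times> int \<Rightarrow> int" where
  "urn_size = (\<lambda>(x, y). \<bar>x\<bar> + \<bar>y\<bar>)"

definition unit_states :: "(int \<times> int) set" where
  "unit_states = {s. urn_size s = 1}"

text \<open>The linear correction cancels the unit drift of \<open>x\<^sup>2 + y\<^sup>2\<close> per step off the axes and matches the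
  loss at each axis crossing.\<close>

definition urn_energy :: "int \<times> int \<Rightarrow> real" where
  "urn_energy = (\<lambda>(x, y). real_of_int (x\<^sup>2 + y\<^sup>2 +
     (if x * y > 0 then \<bar>x\<bar> - \<bar>y\<bar> else if x * y < 0 then \<bar>y\<bar> - \<bar>x\<bar> else - \<bar>x\<bar> - \<bar>y\<bar>)))"

definition step_area :: "int \<times> int \<Rightarrow> int \<times> int \<Rightarrow> real" where
  "step_area s t = real_of_int \<bar>fst s * snd t - snd s * fst t\<bar> / 2"

definition mean_step_area :: "int \<times> int \<Rightarrow> real" where
  "mean_step_area s = measure_pmf.expectation (noisy_urn_step s) (step_area s)"

lemma step_area_nonneg: "0 \<le> step_area s t"
  by (simp add: step_area_def)

lemma mean_step_area_nonneg: "0 \<le> mean_step_area s"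
  by (simp add: mean_step_area_def step_area_nonneg)

lemma urn_size_quarter_turn: "urn_size (quarter_turn s) = urn_size s"
  by (cases s) (simp add: urn_size_def)

lemma urn_energy_quarter_turn: "urn_energy (quarter_turn s) = urn_energy s"
  by (cases s) (auto simp: urn_energy_def mult.commute)

lemma mean_step_area_quarter_turn: "mean_step_area (quarter_turn s) = mean_step_area s"
proof -
  have "step_area (quarter_turn s) (quarter_turn t) = step_area s t" for t
    by (cases s; cases t) (simp add: step_area_def algebra_simps)
  then show ?thesis
    by (simp add: mean_step_area_def noisy_urn_step_quarter_turn)
qed

lemma urn_size_first_quadrant: "0 \<le> x \<Longrightarrow> 0 \<le> y \<Longrightarrow> urn_size (x, y) = x + y"
  by (simp add: urn_size_def)

lemma urn_energy_first_quadrant: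
  "0 \<le> x \<Longrightarrow> 0 < y \<Longrightarrow> urn_energy (x, y) = real_of_int (x\<^sup>2 + y\<^sup>2 + x - y)"
  by (cases "x = 0") (auto simp: urn_energy_def)

lemma urn_energy_axis: "0 \<le> x \<Longrightarrow> urn_energy (x, 0) = real_of_int (x\<^sup>2 - x)"
  by (simp add: urn_energy_def)

lemma urn_energy_axis_step: "2 \<le> x \<Longrightarrow> urn_energy (x - 1, 1) = urn_energy (x, 0)"
  by (simp add: urn_energy_first_quadrant urn_energy_axis power2_eq_square algebra_simps)

lemma urn_energy_interior_steps:
  assumes "0 < x" "0 < y"
  shows "urn_energy (x, y + 1) = urn_energy (x, y) + 2 * y"
    and "urn_energy (x - 1, y) = urn_energy (x, y) - 2 * x"
  using assms by (simp_all add: urn_energy_first_quadrant power2_eq_square algebra_simps)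

lemma square_le_urn_energy:
  assumes "0 < x" "0 < y"
  shows "(real_of_int x)\<^sup>2 \<le> urn_energy (x, y)"
proof -
  have "y \<le> y\<^sup>2"
    using assms by (simp add: power2_eq_square)
  then have "x\<^sup>2 \<le> x\<^sup>2 + y\<^sup>2 + x - y"
    using assms by simp
  then have "real_of_int (x\<^sup>2) \<le> real_of_int (x\<^sup>2 + y\<^sup>2 + x - y)"
    by (simp only: of_int_le_iff)
  then show ?thesis
    using assms by (simp only: urn_energy_first_quadrant of_int_power)
qed

lemma urn_energy_eq_0:
  assumes "s \<in> unit_states"
  shows "urn_energy s = 0"
proof -
  have unit: "urn_size s = 1"
    using assms by (simp add: unit_states_def)
  then have "s \<noteq> (0, 0)"
    by (auto simp: urn_size_def)
  then show ?thesis
    using unit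
  proof (induction s rule: quarter_turn_induct)
    case (first_quadrant x y)
    then have "x = 1" "y = 0"
      by (simp_all add: urn_size_first_quadrant)
    then show ?case
      by (simp add: urn_energy_axis)
  qed (simp add: urn_size_quarter_turn urn_energy_quarter_turn)
qed

lemma urn_size_ge_2_iff: "2 \<le> urn_size s \<longleftrightarrow> s \<in> - {(0, 0)} - unit_states"
  by (cases s) (auto simp: urn_size_def unit_states_def)

lemma urn_size_induct [consumes 1, case_names axis interior turn]:
  assumes "2 \<le> urn_size s"
    and axis: "\<And>x. 2 \<le> x \<Longrightarrow> P (x, 0)"
    and interior: "\<And>x y. 0 < x \<Longrightarrow> 0 < y \<Longrightarrow> P (x, y)"
    and turn: "\<And>s. P s \<Longrightarrow> P (quarter_turn s)"
  shows "P s"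
proof -
  have "s \<noteq> (0, 0)"
    using assms(1) by (auto simp: urn_size_def)
  then show ?thesis
    using assms(1)
  proof (induction s rule: quarter_turn_induct)
    case (first_quadrant x y)
    then show ?case
      by (cases "y = 0") (auto simp: urn_size_first_quadrant intro: axis interior)
  qed (simp add: urn_size_quarter_turn turn)
qed

lemma urn_energy_pos: "2 \<le> urn_size s \<Longrightarrow> 0 < urn_energy s"
proof (induction s rule: urn_size_induct)
  case (axis x)
  then have "x < x\<^sup>2"
    by (simp add: power2_eq_square)
  then show ?case
    using axis by (simp add: urn_energy_axis flip: of_int_power)
next
  case (interior x y)
  then have "0 < (real_of_int x)\<^sup>2"
    by simp
  also have "\<dots> \<le> urn_energy (x, y)"
    using interior by (rule square_le_urn_energy)
  finally show ?case .
qed (simp add: urn_energy_quarter_turn)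

lemma urn_energy_nonneg: "0 \<le> urn_energy s"
proof -
  consider "s = (0, 0)" | "s \<in> unit_states" | "2 \<le> urn_size s"
    using urn_size_ge_2_iff by blast
  then show ?thesis
    by cases (auto simp: urn_energy_axis urn_energy_eq_0 dest: urn_energy_pos)
qed

lemma sqrt_urn_energy_le:
  assumes "2 \<le> urn_size s"
  shows "sqrt (urn_energy s) \<le> 2 * urn_size s"
proof -
  have "urn_energy s \<le> (real_of_int (2 * urn_size s))\<^sup>2"
    using assms
  proof (induction s rule: urn_size_induct)
    case (axis x)
    have "0 \<le> 3 * x\<^sup>2 + x"
      using axis by simp
    then have "x\<^sup>2 - x \<le> (2 * x)\<^sup>2"
      by (simp add: power_mult_distrib)
    with axis show ?case
      by (simp only: urn_energy_axis urn_size_first_quadrant add_0_right order_refl of_int_le_iff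
          flip: of_int_power)
  next
    case (interior x y)
    then have "x \<le> x\<^sup>2" "0 \<le> x * y"
      by (simp_all add: power2_eq_square)
    moreover have "(2 * (x + y))\<^sup>2 = 4 * x\<^sup>2 + 4 * y\<^sup>2 + 8 * (x * y)"
      by (simp add: power2_eq_square algebra_simps)
    ultimately have "x\<^sup>2 + y\<^sup>2 + x - y \<le> (2 * (x + y))\<^sup>2"
      using interior zero_le_power2[of y] by linarith
    with interior show ?case
      by (simp only: urn_energy_first_quadrant urn_size_first_quadrant less_imp_le of_int_le_iff
          flip: of_int_power)
  qed (simp add: urn_energy_quarter_turn urn_size_quarter_turn)
  then show ?thesis
    using assms by (intro real_le_lsqrt) (simp_all add: urn_energy_nonneg)
qed

lemma expectation_urn_energy_step:
  "2 \<le> urn_size s \<Longrightarrow> measure_pmf.expectation (noisy_urn_step s) urn_energy = urn_energy s"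
proof (induction s rule: urn_size_induct)
  case (axis x)
  then show ?case
    by (simp add: noisy_urn_step_axis urn_energy_axis_step)
next
  case (interior x y)
  then have "measure_pmf.expectation (noisy_urn_step (x, y)) urn_energy =
      (x * (urn_energy (x, y) + 2 * y) + y * (urn_energy (x, y) - 2 * x)) / (x + y)"
    by (simp add: expectation_noisy_urn_step_interior urn_energy_interior_steps)
  also have "\<dots> = urn_energy (x, y)"
    using interior by (simp add: field_simps)
  finally show ?case .
qed (simp add: noisy_urn_step_quarter_turn urn_energy_quarter_turn)

lemma variance_urn_energy_step_le:
  assumes "2 \<le> urn_size s"
  shows "measure_pmf.variance (noisy_urn_step s) urn_energy \<le> 4 * urn_size s * sqrt (urn_energy s)"
  unfolding expectation_urn_energy_step[OF assms]
  using assms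
proof (induction s rule: urn_size_induct)
  case (axis x)
  then show ?case
    by (simp add: noisy_urn_step_axis urn_energy_axis_step urn_energy_nonneg urn_size_first_quadrant)
next
  case (interior x y)
  have "measure_pmf.expectation (noisy_urn_step (x, y)) (\<lambda>t. (urn_energy t - urn_energy (x, y))\<^sup>2) =
      (x * (2 * y)\<^sup>2 + y * (2 * x)\<^sup>2) / (x + y)"
    using interior by (simp add: expectation_noisy_urn_step_interior urn_energy_interior_steps)
  also have "\<dots> = 4 * (real_of_int y * x)"
    using interior by (simp add: field_simps power2_eq_square)
  also have "\<dots> \<le> 4 * (real_of_int (x + y) * sqrt (urn_energy (x, y)))"
    using interior square_le_urn_energy[OF interior]
    by (intro mult_mono) (auto intro: real_le_rsqrt)
  also have "\<dots> = 4 * urn_size (x, y) * sqrt (urn_energy (x, y))"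
    using interior by (simp add: urn_size_first_quadrant)
  finally show ?case .
qed (simp add: noisy_urn_step_quarter_turn urn_energy_quarter_turn urn_size_quarter_turn)

lemma expectation_sqrt_cube_urn_energy_step_le:
  assumes "2 \<le> urn_size s"
  shows "measure_pmf.expectation (noisy_urn_step s) (\<lambda>t. sqrt (urn_energy t) ^ 3) \<le>
    sqrt (urn_energy s) ^ 3 + 4 * urn_size s"
proof -
  have "measure_pmf.expectation (noisy_urn_step s) (\<lambda>t. sqrt (urn_energy t) ^ 3) \<le>
      sqrt (urn_energy s) ^ 3 +
      measure_pmf.variance (noisy_urn_step s) urn_energy / sqrt (urn_energy s)"
    using measure_pmf.expectation_sqrt_cube_le[of urn_energy "noisy_urn_step s"]
    by (simp add: expectation_urn_energy_step assms urn_energy_nonneg urn_energy_pos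
        integrable_measure_pmf_finite finite_set_pmf_noisy_urn_step)
  also have "measure_pmf.variance (noisy_urn_step s) urn_energy / sqrt (urn_energy s) \<le> 4 * urn_size s"
    using variance_urn_energy_step_le[OF assms] urn_energy_pos[OF assms]
    by (simp add: divide_le_eq)
  finally show ?thesis
    by simp
qed

lemma urn_size_le_mean_step_area: "2 \<le> urn_size s \<Longrightarrow> urn_size s \<le> 4 * mean_step_area s"
proof (induction s rule: urn_size_induct)
  case (axis x)
  then show ?case
    by (simp add: mean_step_area_def step_area_def noisy_urn_step_axis urn_size_first_quadrant)
next
  case (interior x y)
  have "urn_size (x, y) * (real_of_int x + y) = (real_of_int x + y)\<^sup>2"
    using interior by (simp add: urn_size_first_quadrant power2_eq_square)
  also have "\<dots> \<le> 2 * (x\<^sup>2 + y\<^sup>2)"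
    using zero_le_power2[of "real_of_int x - y"] by (simp add: power2_eq_square algebra_simps)
  finally have "urn_size (x, y) \<le> 2 * (x\<^sup>2 + y\<^sup>2) / (real_of_int x + y)"
    using interior by (simp add: pos_le_divide_eq)
  also have "\<dots> = 4 * mean_step_area (x, y)"
    using interior
    by (simp add: mean_step_area_def step_area_def expectation_noisy_urn_step_interior
        power2_eq_square field_simps)
  finally show ?case .
qed (simp add: urn_size_quarter_turn mean_step_area_quarter_turn)

lemma measure_triangle_plane_point:
  "measure lebesgue (convex hull {0, plane_point s, plane_point t}) = step_area s t"
proof -
  have "compact (convex hull {0, plane_point s, plane_point t})"
    by (intro finite_imp_compact_convex_hull) simp
  then have "measure lebesgue (convex hull {0, plane_point s, plane_point t}) =
      measure lborel (convex hull {0, plane_point s, plane_point t})"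
    by (intro measure_completion) (auto dest: compact_imp_closed)
  then show ?thesis
    by (simp add: content_triangle plane_point_def step_area_def abs_minus_commute mult.commute)
qed

lemma Suc_le_urn_tau_iff: "enat (Suc k) \<le> urn_tau Z \<omega> \<longleftrightarrow> (\<forall>i\<le>k. Z i \<omega> \<notin> unit_states)"
  unfolding urn_tau_def le_Inf_iff unit_states_def urn_size_def
  by (auto simp: split_beta) (metis not_less_eq_eq)

locale noisy_harmonic_urn =
  countable_markov_chain M "- {(0, 0)}" noisy_urn_step "(int z0, 1)" Z
  for M :: "'a measure" and z0 :: nat and Z :: "nat \<Rightarrow> 'a \<Rightarrow> int \<times> int" +
  assumes z0_ge_1: "1 \<le> z0"
begin

lemma nn_integral_urn_area:
  "(\<integral>\<^sup>+\<omega>. urn_area Z \<omega> \<partial>M) =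
    (\<Sum>n. \<integral>\<^sup>+s. ennreal (mean_step_area s) \<partial>killed_law unit_states n)"
proof -
  have [measurable]: "(\<lambda>\<omega>. step_area (Z n \<omega>) (Z (Suc n) \<omega>)) \<in> borel_measurable M" for n
    using measurable_compose[OF measurable_Pair_count_space, of _ M _ "case_prod step_area" borel]
    by simp
  have "(\<integral>\<^sup>+\<omega>. urn_area Z \<omega> \<partial>M) = (\<integral>\<^sup>+\<omega>. (\<Sum>n. ennreal (step_area (Z n \<omega>) (Z (Suc n) \<omega>)) *
      indicator (surviving unit_states n) \<omega>) \<partial>M)"
    unfolding urn_area_def Suc_le_urn_tau_iff urn_triangle_def measure_triangle_plane_point diff_Suc_1
    by (intro nn_integral_cong suminf_cong) (auto simp: surviving_def)
  also have "\<dots> = (\<Sum>n. \<integral>\<^sup>+s. \<integral>\<^sup>+t. ennreal (step_area s t) \<partial>noisy_urn_step s \<partial>killed_law unit_states n)"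
    by (subst nn_integral_suminf)
       (simp_all add: nn_integral_surviving_Suc[of "\<lambda>s t. ennreal (step_area s t)"])
  finally show ?thesis
    by (simp add: nn_integral_noisy_urn_step mean_step_area_def step_area_nonneg)
qed

lemma suminf_mean_step_area_eq_top:
  "(\<Sum>n. \<integral>\<^sup>+s. ennreal (16 * mean_step_area s) \<partial>killed_law unit_states n) = \<top>"
proof (rule suminf_nn_integral_killed_law_eq_top)
  show "(int z0, 1) \<notin> unit_states" "0 < urn_energy (int z0, 1)"
    using z0_ge_1 by (auto simp: unit_states_def urn_size_def intro: urn_energy_pos)
  show "0 \<le> sqrt (urn_energy s) ^ 3" "0 \<le> 16 * mean_step_area s" for s
    by (simp_all add: urn_energy_nonneg mean_step_area_nonneg)
  show "urn_energy s = 0" "sqrt (urn_energy s) ^ 3 = 0" if "s \<in> unit_states" for s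
    using that by (simp_all add: urn_energy_eq_0)
next
  fix s assume "s \<in> - {(0, 0)} - unit_states"
  then have size: "2 \<le> urn_size s"
    by (simp only: urn_size_ge_2_iff)
  show "(\<integral>\<^sup>+t. ennreal (urn_energy t) \<partial>noisy_urn_step s) = ennreal (urn_energy s)"
    by (simp add: nn_integral_noisy_urn_step urn_energy_nonneg expectation_urn_energy_step size)
  have "measure_pmf.expectation (noisy_urn_step s) (\<lambda>t. sqrt (urn_energy t) ^ 3) \<le>
      sqrt (urn_energy s) ^ 3 + 16 * mean_step_area s"
    using expectation_sqrt_cube_urn_energy_step_le[OF size] urn_size_le_mean_step_area[OF size]
    by linarith
  then show "(\<integral>\<^sup>+t. ennreal (sqrt (urn_energy t) ^ 3) \<partial>noisy_urn_step s) \<le>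
      ennreal (sqrt (urn_energy s) ^ 3) + ennreal (16 * mean_step_area s)"
    by (simp add: nn_integral_noisy_urn_step urn_energy_nonneg mean_step_area_nonneg ennreal_leI
        flip: ennreal_plus)
  have "(urn_energy s)\<^sup>2 = sqrt (urn_energy s) * sqrt (urn_energy s) ^ 3"
    by (simp add: urn_energy_nonneg power2_eq_square power3_eq_cube)
  also have "\<dots> \<le> 16 * mean_step_area s * sqrt (urn_energy s) ^ 3"
    using sqrt_urn_energy_le[OF size] urn_size_le_mean_step_area[OF size] mean_step_area_nonneg[of s]
    by (intro mult_right_mono) (auto simp: urn_energy_nonneg)
  finally show "(urn_energy s)\<^sup>2 \<le> 16 * mean_step_area s * sqrt (urn_energy s) ^ 3" .
qed

end

theorem theorem2p10:
  fixes M :: "'a measure" and z0 :: nat and Z :: "nat \<Rightarrow> 'a \<Rightarrow> int \<times> int"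
  assumes "prob_space M"
    and "z0 \<ge> 1"
    and "noisy_urn M z0 Z"
  shows "(\<integral>\<^sup>+ \<omega>. urn_area Z \<omega> \<partial>M) = \<infinity>"
proof -
  interpret prob_space M by fact
  interpret noisy_harmonic_urn M z0 Z
    using assms(2,3) by unfold_locales (simp_all add: noisy_urn_def)
  have "16 * (\<integral>\<^sup>+ \<omega>. urn_area Z \<omega> \<partial>M) =
      (\<Sum>n. \<integral>\<^sup>+s. ennreal (16 * mean_step_area s) \<partial>killed_law unit_states n)"
    by (simp add: nn_integral_urn_area mean_step_area_nonneg ennreal_mult nn_integral_cmult)
  also have "\<dots> = \<top>"
    by (rule suminf_mean_step_area_eq_top)
  finally show ?thesis
    by (simp add: ennreal_mult_eq_top_iff)
qed

end
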